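(* If $T$ and $T'$ are trees of respective orders $n$ and $n'$, then $$f(T \,\square\, T') \leq f(S_{n} \,\square\, S_{n'}).$$
   Context: The order of a graph is its number of vertices. $S_n$ denotes the star $K_{1,n-1}$ on $n$ vertices. The forest number $f(G)$ of a graph $G$ is the maximum number of vertices of a set $X\subseteq V(G)$ such that the induced subgraph $G[X]$ is a forest (contains no cycle). The Cartesian product $G \,\square\, H$ has vertex set $V(G)\times V(H)$, and two vertices $(g,h)$ and $(g',h')$ are adjacent if either $g=g'$ and $hh'\in E(H)$, or $gg'\in E(G)$ and $h=h'$. *)

theory Defs
  imports "Graph_Theory.Graph_Theory"
begin

text \<open>
  Finite simple graphs are symmetric loop-free digraphs without parallel arcs, that is, the
  locale \<^locale>\<open>pair_graph\<close>: every edge $uv$ is represented by the two arcs $(u,v)$ and $(v,u)$.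

  For such a graph \<^const>\<open>pre_digraph.cycle\<close> also accepts the closed walk $u, v, u$ that runs
  along an edge and back, so \<^const>\<open>forest\<close> and \<^const>\<open>tree\<close> fail as soon as there is
  an edge. The cycles of the underlying undirected simple graph are those of length at least 3.
\<close>

definition undirected_forest :: "('a,'b) pre_digraph \<Rightarrow> bool" where
  "undirected_forest G \<longleftrightarrow> \<not> (\<exists>p. pre_digraph.cycle G p \<and> 3 \<le> length p)"

text \<open>\<^const>\<open>connected\<close> excludes the graph without vertices.\<close>

definition undirected_tree :: "'a pair_pre_digraph \<Rightarrow> bool" where
  "undirected_tree T \<longleftrightarrow>
     pair_graph T \<and> connected (with_proj T) \<and> undirected_forest (with_proj T)"

definition forest_number :: "'a pair_pre_digraph \<Rightarrow> nat" where
  "forest_number G =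
     Max {card X |X. X \<subseteq> pverts G \<and> undirected_forest (with_proj G \<restriction> X)}"

definition cartesian_product ::
  "'a pair_pre_digraph \<Rightarrow> 'b pair_pre_digraph \<Rightarrow> ('a \<times> 'b) pair_pre_digraph" (infixr "\<box>" 70) where
  "G \<box> H = \<lparr> pverts = pverts G \<times> pverts H,
     parcs = {((g, h), (g', h')) |g h g' h'.
       (g = g' \<and> g \<in> pverts G \<and> (h, h') \<in> parcs H) \<or>
       ((g, g') \<in> parcs G \<and> h = h' \<and> h \<in> pverts H)} \<rparr>"

text \<open>The star $K_{1,n-1}$, with vertices $0, \ldots, n-1$ and centre $0$.\<close>

definition star_graph :: "nat \<Rightarrow> nat pair_pre_digraph" where
  "star_graph n = \<lparr> pverts = {..<n}, parcs = {0} \<times> {1..<n} \<union> {1..<n} \<times> {0} \<rparr>"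

lemma star_graph_complete_bipartite:
  assumes "n \<ge> 1"
  shows "K\<^bsub>1,n - 1\<^esub> (with_proj (star_graph n))"
  unfolding complete_bipartite_digraph_pair_def
  using assms
  by (intro conjI exI[of _ "{0}"] exI[of _ "{1..<n}"]) (auto simp: star_graph_def)

lemma pair_graph_cartesian_product:
  assumes "pair_graph G" "pair_graph H"
  shows "pair_graph (G \<box> H)"
proof -
  interpret G: pair_graph G by fact
  interpret H: pair_graph H by fact
  have sub: "parcs (G \<box> H) \<subseteq> pverts (G \<box> H) \<times> pverts (G \<box> H)"
    by (auto simp: cartesian_product_def dest: G.in_arcsD1 G.in_arcsD2 H.in_arcsD1 H.in_arcsD2)
  have fin: "finite (pverts (G \<box> H))"
    by (simp add: cartesian_product_def)
  have "finite (parcs (G \<box> H))"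
    using sub fin by (meson finite_SigmaI finite_subset)
  moreover have "sym (parcs (G \<box> H))"
    using G.sym_arcs H.sym_arcs
    by (auto simp: cartesian_product_def symmetric_def intro!: symI dest: symD)
  moreover have "fst e \<noteq> snd e" if "e \<in> parcs (G \<box> H)" for e
    using that G.pair_no_loops H.pair_no_loops by (fastforce simp: cartesian_product_def)
  ultimately show ?thesis
    using sub fin by unfold_locales (auto simp: symmetric_def)
qed

lemma forest_number_set_finite_nonempty:
  assumes "finite (pverts G)"
  shows "finite {card X |X. X \<subseteq> pverts G \<and> undirected_forest (with_proj G \<restriction> X)}"
    and "{card X |X. X \<subseteq> pverts G \<and> undirected_forest (with_proj G \<restriction> X)} \<noteq> {}"
proof -
  show "finite {card X |X. X \<subseteq> pverts G \<and> undirected_forest (with_proj G \<restriction> X)}"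
    using assms by simp
  have "undirected_forest (with_proj G \<restriction> {})"
    by (auto simp: undirected_forest_def pre_digraph.cycle_def pre_digraph.awalk_def)
  then show "{card X |X. X \<subseteq> pverts G \<and> undirected_forest (with_proj G \<restriction> X)} \<noteq> {}"
    by blast
qed

end

theory Submission
  imports Defs
begin

text \<open>
  Both sides are compared with $n n' - \min (n - 1) (n' - 1)$.

  Upper bound for trees: let $X$ induce a forest in $T \mathbin{\Box} T'$ and let $D$ be the set of
  the remaining vertices. If $|D| \le \min n\, n' - 2$, then $D$ misses two copies
  $\{g\} \times T'$, $\{g'\} \times T'$ of $T'$ and two copies $T \times \{h\}$, $T \times \{h'\}$
  of $T$. A path from $g$ to $g'$ in $T$ and a path from $h$ to $h'$ in $T'$, each traversed once
  forwards and once backwards in the respective copies, form the boundary of a rectangle, which is a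
  cycle inside $X$ (\<open>rectangle_cycle\<close>). Hence $|D| \ge \min (n - 1) (n' - 1)$.

  Lower bound for stars: the bound is attained by deleting all vertices $(i, 0)$ with $i \ge 1$, or
  all $(0, j)$ with $j \ge 1$, whichever are fewer. What is left is a tree of depth at most two
  rooted at $(0, 0)$ (\<open>star_product_forest\<close>).
\<close>

section \<open>Cycles in induced subgraphs\<close>

lemma pcas_verts_shift: "pcas u p v \<Longrightarrow> map fst p @ [v] = u # map snd p"
  by (induction u p v rule: pcas.induct) auto

lemma pcas_append: "pcas u p v \<Longrightarrow> pcas v q w \<Longrightarrow> pcas u (p @ q) w"
  by (induction u p v rule: pcas.induct) auto

lemma pcas_map_prod: "pcas u p v \<Longrightarrow> pcas (f u) (map (map_prod f f) p) (f v)"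
  by (induction u p v rule: pcas.induct) auto

text \<open>
  For a closed walk, the vertices after the first are the heads of the arcs, so that cycles can be
  recognised, and assembled from pieces, by means of the list of heads alone.
\<close>
lemma cycle_induce_subgraph_iff:
  "pre_digraph.cycle (with_proj G \<restriction> X) p \<longleftrightarrow>
     p \<noteq> [] \<and> set p \<subseteq> parcs G \<inter> X \<times> X \<and> distinct (map snd p) \<and> (\<exists>u. pcas u p u)"
proof -
  have cas: "pre_digraph.cas (with_proj G \<restriction> X) u q v = pcas u q v" for u q v
    by (induction u q v rule: pcas.induct)
      (auto simp: pre_digraph.cas.simps induce_subgraph_def)
  have verts: "pre_digraph.awalk_verts (with_proj G \<restriction> X) u q = pawalk_verts u q" for u q
    by (induction q arbitrary: u) (auto simp: pre_digraph.awalk_verts.simps induce_subgraph_def)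
  have tl: "tl (pawalk_verts u q) = map snd q" if "pcas u q v" for u q v
  proof -
    have "pawalk_verts u q = u # map snd q"
      using that by (induction u q v rule: pcas.induct) auto
    then show ?thesis by simp
  qed
  have start: "u \<in> X" if "pcas u p u" "p \<noteq> []" "set p \<subseteq> parcs G \<inter> X \<times> X" for u
    using that by (cases p) auto
  have arcs: "arcs (with_proj G \<restriction> X) = parcs G \<inter> X \<times> X"
    by (auto simp: induce_subgraph_def)
  show ?thesis
    unfolding pre_digraph.cycle_def pre_digraph.awalk_def cas verts arcs induce_subgraph_verts
    using tl start by metis
qed

text \<open>
  Both neighbours, on a cycle, of a vertex of maximal rank must be its parent. So they coincide, which
  is impossible if the cycle has at least three arcs.
\<close>
lemma undirected_forest_if_parent:
  fixes rank :: "'a \<Rightarrow> nat"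
  assumes "\<And>u v. (u, v) \<in> parcs G \<Longrightarrow> u \<in> X \<Longrightarrow> v \<in> X \<Longrightarrow>
    v = parent u \<and> rank v < rank u \<or> u = parent v \<and> rank u < rank v"
  shows "undirected_forest (with_proj G \<restriction> X)"
  unfolding undirected_forest_def
proof
  assume "\<exists>p. pre_digraph.cycle (with_proj G \<restriction> X) p \<and> 3 \<le> length p"
  then obtain p u where len: "3 \<le> length p" and arcs: "set p \<subseteq> parcs G \<inter> X \<times> X"
    and dist: "distinct (map snd p)" and cas: "pcas u p u"
    by (auto simp: cycle_induce_subgraph_iff)
  define k where "k = length p"
  have shift: "map fst p @ [u] = u # map snd p"
    using cas by (rule pcas_verts_shift)
  then have "mset (map fst p) = mset (map snd p)"
    by (metis add_mset_add_single add_right_cancel mset.simps mset_append)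
  then have dist': "distinct (map fst p)"
    using dist mset_eq_imp_distinct_iff by blast
  have next_arc: "fst (p ! (Suc i mod k)) = snd (p ! i)" if "i < k" for i
  proof -
    have eq: "(map fst p @ [u]) ! Suc i = snd (p ! i)"
      using shift that by (simp add: k_def)
    show ?thesis
    proof (cases "Suc i < k")
      case True
      then show ?thesis using eq by (simp add: nth_append k_def)
    next
      case False
      then have "Suc i = k" using that by simp
      moreover have "fst (p ! 0) = u"
        using cas len by (cases p) auto
      ultimately show ?thesis using eq by (simp add: nth_append k_def)
    qed
  qed
  have "Max ((\<lambda>i. rank (snd (p ! i))) ` {..<k}) \<in> (\<lambda>i. rank (snd (p ! i))) ` {..<k}"
    using len by (intro Max_in) (auto simp: k_def lessThan_empty_iff)
  then obtain i where i: "i < k"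
    and "rank (snd (p ! i)) = Max ((\<lambda>i. rank (snd (p ! i))) ` {..<k})"
    by auto
  then have max: "rank (snd (p ! j)) \<le> rank (snd (p ! i))" if "j < k" for j
    using that by simp
  define j where "j = Suc i mod k"
  have "0 < k" using len unfolding k_def by linarith
  then have j: "j < k" by (simp add: j_def)
  obtain l where l: "l < k" "snd (p ! l) = fst (p ! i)"
  proof -
    have "set (map fst p) = set (map snd p)"
      using \<open>mset (map fst p) = mset (map snd p)\<close> by (rule mset_eq_setD)
    then have "fst (p ! i) \<in> set (map snd p)"
      using i by (metis k_def length_map nth_map nth_mem)
    then show ?thesis using that by (auto simp: in_set_conv_nth k_def)
  qed
  have arc: "(fst (p ! m), snd (p ! m)) \<in> parcs G \<and> fst (p ! m) \<in> X \<and> snd (p ! m) \<in> X"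
    if "m < k" for m
    using arcs nth_mem[of m p] that by (fastforce simp: k_def)
  have "fst (p ! i) = parent (snd (p ! i))"
    using assms arc[OF i] max[OF l(1)] l(2) by fastforce
  moreover have "snd (p ! j) = parent (snd (p ! i))"
    using assms arc[OF j] max[OF j] next_arc[OF i] unfolding j_def by fastforce
  ultimately have "fst (p ! i) = fst (p ! (Suc j mod k))"
    using next_arc[OF j] by simp
  moreover have "Suc j mod k < k" using \<open>0 < k\<close> by simp
  ultimately have "i = Suc j mod k"
    using nth_eq_iff_index_eq[OF dist', of i "Suc j mod k"] i by (simp add: k_def)
  moreover have "Suc j mod k \<noteq> i"
    using i len by (auto simp: j_def k_def mod_Suc split: if_splits)
  ultimately show False by simp
qed

section \<open>Products of connected graphs\<close>

lemma obtain_apath: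
  assumes "pair_graph G" "connected (with_proj G)" "u \<in> pverts G" "v \<in> pverts G" "u \<noteq> v"
  obtains p where "p \<noteq> []" "set p \<subseteq> parcs G" "pcas u p v" "distinct (u # map snd p)"
proof -
  interpret G: pair_graph G by fact
  have "strongly_connected (with_proj G)"
    using G.symmetric_connected_imp_strongly_connected assms(2) G.sym_arcs by blast
  then have "u \<rightarrow>\<^sup>*\<^bsub>with_proj G\<^esub> v"
    using assms(3,4) by (auto simp: strongly_connected_def)
  then obtain p where p: "G.apath u p v"
    using G.reachable_apath by blast
  then have cas: "pcas u p v" and "set p \<subseteq> parcs G" and dist: "distinct (pawalk_verts u p)"
    by (auto simp: G.apath_def G.awalk_def)
  moreover have "pawalk_verts u p = u # map snd p"
    using cas by (induction u p v rule: pcas.induct) auto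
  moreover have "p \<noteq> []" using cas assms(5) by auto
  ultimately show ?thesis using that by metis
qed

lemma rev_path_conv: "rev_path p = rev (map prod.swap p)"
  by (induction p) (auto simp: prod.swap_def)

lemma pcas_rev_path: "pcas u p v \<Longrightarrow> pcas v (rev_path p) u"
  by (induction u p v rule: pcas.induct) (auto intro: pcas_append)

text \<open>
  The two paths bound a rectangle: its sides are copies of them at heights $h$, $h'$ and at
  abscissae $g$, $g'$. Since they are paths, no side meets itself, and two sides meet only in corners.
\<close>
lemma rectangle_cycle:
  assumes T: "pair_graph T" "connected (with_proj T)"
    and T': "pair_graph T'" "connected (with_proj T')"
    and g: "g \<in> pverts T" "g' \<in> pverts T" "g \<noteq> g'"
    and h: "h \<in> pverts T'" "h' \<in> pverts T'" "h \<noteq> h'"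
    and X: "pverts T \<times> {h, h'} \<union> {g, g'} \<times> pverts T' \<subseteq> X"
  shows "\<not> undirected_forest (with_proj (T \<box> T') \<restriction> X)"
proof -
  interpret T: pair_graph T by fact
  interpret T': pair_graph T' by fact
  obtain p where p: "p \<noteq> []" "set p \<subseteq> parcs T" "pcas g p g'" "distinct (g # map snd p)"
    using obtain_apath[OF T g] by blast
  obtain q where q: "q \<noteq> []" "set q \<subseteq> parcs T'" "pcas h q h'" "distinct (h # map snd q)"
    using obtain_apath[OF T' h] by blast
  define row where "row y r = map (map_prod (\<lambda>x. (x, y)) (\<lambda>x. (x, y))) r"
    for y :: 'b and r :: "('a \<times> 'a) list"
  define col where "col x r = map (map_prod (Pair x) (Pair x)) r"
    for x :: 'a and r :: "('b \<times> 'b) list"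
  define c where "c = row h p @ col g' q @ row h' (rev_path p) @ col g (rev_path q)"
  have cas: "pcas (g, h) c (g, h)"
    unfolding c_def row_def col_def
    using pcas_map_prod[OF p(3), of "\<lambda>x. (x, h)"] pcas_map_prod[OF q(3), of "Pair g'"]
      pcas_map_prod[OF pcas_rev_path[OF p(3)], of "\<lambda>x. (x, h')"]
      pcas_map_prod[OF pcas_rev_path[OF q(3)], of "Pair g"]
    by (intro pcas_append)
  have row_arcs: "set (row y r) \<subseteq> parcs (T \<box> T') \<inter> X \<times> X"
    if r: "set r \<subseteq> parcs T" and y: "y \<in> {h, h'}" for r y
  proof
    fix e assume "e \<in> set (row y r)"
    then obtain u v where "(u, v) \<in> parcs T" "e = ((u, y), (v, y))"
      using r by (auto simp: row_def)
    moreover from this have "u \<in> pverts T" "v \<in> pverts T"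
      by (auto dest: T.in_arcsD1 T.in_arcsD2)
    ultimately show "e \<in> parcs (T \<box> T') \<inter> X \<times> X"
      using y h X by (auto simp: cartesian_product_def)
  qed
  have col_arcs: "set (col x r) \<subseteq> parcs (T \<box> T') \<inter> X \<times> X"
    if r: "set r \<subseteq> parcs T'" and x: "x \<in> {g, g'}" for r x
  proof
    fix e assume "e \<in> set (col x r)"
    then obtain u v where "(u, v) \<in> parcs T'" "e = ((x, u), (x, v))"
      using r by (auto simp: col_def)
    moreover from this have "u \<in> pverts T'" "v \<in> pverts T'"
      by (auto dest: T'.in_arcsD1 T'.in_arcsD2)
    ultimately show "e \<in> parcs (T \<box> T') \<inter> X \<times> X"
      using x g X by (auto simp: cartesian_product_def)
  qed
  have rev: "set (rev_path p) \<subseteq> parcs T" "set (rev_path q) \<subseteq> parcs T'"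
    using p(2) q(2) T.arcs_symmetric T'.arcs_symmetric by (fastforce simp: rev_path_conv)+
  have arcs: "set c \<subseteq> parcs (T \<box> T') \<inter> X \<times> X"
    using row_arcs[OF p(2)] col_arcs[OF q(2)] row_arcs[OF rev(1)] col_arcs[OF rev(2)]
    unfolding c_def by simp
  have heads: "map snd (row y r) = map (\<lambda>x. (x, y)) (map snd r)"
    "map snd (col x s) = map (Pair x) (map snd s)" for x y r s
    by (simp_all add: row_def col_def)
  have heads_rev: "map snd (rev_path r) = rev (map fst r)" for r :: "('c \<times> 'c) list"
    by (simp add: rev_path_conv rev_map)
  have pf: "map fst p @ [g'] = g # map snd p" and qf: "map fst q @ [h'] = h # map snd q"
    using p(3) q(3) by (auto dest: pcas_verts_shift)
  have p_dist: "distinct (map fst p @ [g'])" "distinct (map snd p)" "g \<notin> set (map snd p)"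
    unfolding pf using p(4) by simp_all
  have q_dist: "distinct (map fst q @ [h'])" "distinct (map snd q)" "h \<notin> set (map snd q)"
    unfolding qf using q(4) by simp_all
  \<comment> \<open>Listing only the heads of its arcs, each side omits its first corner, which is the last vertex
    of the preceding side; hence no corner is repeated.\<close>
  have "distinct (map snd c)"
    unfolding c_def map_append heads heads_rev
    using p_dist q_dist g(3) h(3)
    by (simp add: distinct_map inj_on_def) auto
  moreover have "3 \<le> length c"
    using p(1) q(1) by (cases p; cases q) (auto simp: c_def row_def col_def)
  moreover from this have "c \<noteq> []" by auto
  ultimately have "pre_digraph.cycle (with_proj (T \<box> T') \<restriction> X) c \<and> 3 \<le> length c"
    using arcs cas unfolding cycle_induce_subgraph_iff by blast
  then show ?thesis unfolding undirected_forest_def by blast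
qed

lemma card_induced_forest_product_le:
  assumes T: "pair_graph T" "connected (with_proj T)"
    and T': "pair_graph T'" "connected (with_proj T')"
    and X: "X \<subseteq> pverts T \<times> pverts T'" "undirected_forest (with_proj (T \<box> T') \<restriction> X)"
  shows "card X + min (card (pverts T) - 1) (card (pverts T') - 1) \<le>
    card (pverts T) * card (pverts T')"
proof -
  interpret T: pair_graph T by fact
  interpret T': pair_graph T' by fact
  define D where "D = pverts T \<times> pverts T' - X"
  have fin: "finite D" by (simp add: D_def)
  have "card X + card D = card (pverts T) * card (pverts T')"
    unfolding D_def using X(1)
    by (metis T.pair_finite_verts T'.pair_finite_verts card_Diff_subset card_cartesian_product
        card_mono finite_SigmaI finite_subset le_add_diff_inverse)
  moreover have "min (card (pverts T) - 1) (card (pverts T') - 1) \<le> card D"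
  proof (rule ccontr)
    assume "\<not> ?thesis"
    then have small: "card D + 2 \<le> card (pverts T)" "card D + 2 \<le> card (pverts T')"
      by auto
    have two: "\<exists>x y. x \<in> A - B \<and> y \<in> A - B \<and> x \<noteq> y"
      if "card B \<le> card D" "finite B" "card D + 2 \<le> card A" for A B :: "'c set"
    proof -
      have "2 \<le> card (A - B)"
        using diff_card_le_card_Diff[OF that(2), of A] that by linarith
      then obtain S where "S \<subseteq> A - B" "card S = 2"
        by (meson obtain_subset_with_card_n)
      then show ?thesis by (auto simp: card_2_iff)
    qed
    obtain g g' where g: "g \<in> pverts T - fst ` D" "g' \<in> pverts T - fst ` D" "g \<noteq> g'"
      using two[OF card_image_le[OF fin] _ small(1)] fin by blast
    obtain h h' where h: "h \<in> pverts T' - snd ` D" "h' \<in> pverts T' - snd ` D" "h \<noteq> h'"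
      using two[OF card_image_le[OF fin] _ small(2)] fin by blast
    have "pverts T \<times> {h, h'} \<union> {g, g'} \<times> pverts T' \<subseteq> X"
    proof
      fix z assume "z \<in> pverts T \<times> {h, h'} \<union> {g, g'} \<times> pverts T'"
      then have "z \<in> pverts T \<times> pverts T'" "z \<notin> D"
        using g h by (auto simp: image_iff)
      then show "z \<in> X" by (simp add: D_def)
    qed
    then show False
      using rectangle_cycle[OF T T', of g g' h h' X] g h X(2) by blast
  qed
  ultimately show ?thesis by linarith
qed

section \<open>Products of stars\<close>

text \<open>
  The rank of a vertex is its number of nonzero coordinates, its distance from $(0,0)$ in the
  whole product. A vertex with two nonzero coordinates has two neighbours of smaller rank, one on each
  axis; deleting one axis up to the origin leaves a single one, its parent.
\<close>
lemma star_product_forest: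
  "undirected_forest (with_proj (star_graph n \<box> star_graph n') \<restriction>
     ({..<n} \<times> {..<n'} - {1..<n} \<times> {0}))"
  "undirected_forest (with_proj (star_graph n \<box> star_graph n') \<restriction>
     ({..<n} \<times> {..<n'} - {0} \<times> {1..<n'}))"
proof -
  let ?rank = "\<lambda>(i :: nat, j :: nat). of_bool (i \<noteq> 0) + of_bool (j \<noteq> 0)"
  show "undirected_forest (with_proj (star_graph n \<box> star_graph n') \<restriction>
     ({..<n} \<times> {..<n'} - {1..<n} \<times> {0}))"
    by (rule undirected_forest_if_parent[where rank = ?rank
          and parent = "\<lambda>(i, j). if i \<noteq> 0 then (0, j) else (0, 0)"])
      (auto simp: cartesian_product_def star_graph_def)
  show "undirected_forest (with_proj (star_graph n \<box> star_graph n') \<restriction>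
     ({..<n} \<times> {..<n'} - {0} \<times> {1..<n'}))"
    by (rule undirected_forest_if_parent[where rank = ?rank
          and parent = "\<lambda>(i, j). if j \<noteq> 0 then (i, 0) else (0, 0)"])
      (auto simp: cartesian_product_def star_graph_def)
qed

lemma forest_number_star_product_ge:
  assumes "0 < n" "0 < n'"
  shows "n * n' - min (n - 1) (n' - 1) \<le> forest_number (star_graph n \<box> star_graph n')"
proof -
  have verts: "pverts (star_graph n \<box> star_graph n') = {..<n} \<times> {..<n'}"
    by (simp add: cartesian_product_def star_graph_def)
  have ge: "card X \<le> forest_number (star_graph n \<box> star_graph n')"
    if "X \<subseteq> {..<n} \<times> {..<n'}"
      "undirected_forest (with_proj (star_graph n \<box> star_graph n') \<restriction> X)" for X
    unfolding forest_number_def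
    by (rule Max_ge[OF forest_number_set_finite_nonempty(1)]) (use that verts in auto)
  have "{1..<n} \<times> {0} \<subseteq> {..<n} \<times> {..<n'}" "{0} \<times> {1..<n'} \<subseteq> {..<n} \<times> {..<n'}"
    using assms by auto
  then have "card ({..<n} \<times> {..<n'} - {1..<n} \<times> {0}) = n * n' - (n - 1)"
    "card ({..<n} \<times> {..<n'} - {0} \<times> {1..<n'}) = n * n' - (n' - 1)"
    by (simp_all add: card_Diff_subset card_cartesian_product)
  then show ?thesis
    using ge[OF Diff_subset star_product_forest(1)] ge[OF Diff_subset star_product_forest(2)]
    by (auto simp: min_def)
qed

theorem mainTheorem1:
  fixes T :: "'a pair_pre_digraph" and T' :: "'b pair_pre_digraph" and n n' :: nat
  assumes "undirected_tree T" and "card (pverts T) = n"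
    and "undirected_tree T'" and "card (pverts T') = n'"
  shows "forest_number (T \<box> T') \<le> forest_number (star_graph n \<box> star_graph n')"
proof -
  have T: "pair_graph T" "connected (with_proj T)"
    and T': "pair_graph T'" "connected (with_proj T')"
    using assms(1,3) by (auto simp: undirected_tree_def)
  interpret T: pair_graph T by fact
  interpret T': pair_graph T' by fact
  interpret P: pair_graph "T \<box> T'"
    using T(1) T'(1) by (rule pair_graph_cartesian_product)
  have verts: "pverts (T \<box> T') = pverts T \<times> pverts T'"
    by (simp add: cartesian_product_def)
  have "pverts T \<noteq> {}" "pverts T' \<noteq> {}"
    using T(2) T'(2) by (auto simp: connected_conv)
  then have pos: "0 < n" "0 < n'"
    using assms(2,4) by (auto simp: card_gt_0_iff)
  note family = forest_number_set_finite_nonempty[OF P.pair_finite_verts]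
  obtain X where X: "X \<subseteq> pverts T \<times> pverts T'"
      "undirected_forest (with_proj (T \<box> T') \<restriction> X)" "forest_number (T \<box> T') = card X"
    using Max_in[OF family] unfolding forest_number_def verts by blast
  have "forest_number (T \<box> T') \<le> n * n' - min (n - 1) (n' - 1)"
    using card_induced_forest_product_le[OF T T' X(1,2)] assms(2,4) X(3) by simp
  also have "\<dots> \<le> forest_number (star_graph n \<box> star_graph n')"
    using forest_number_star_product_ge[OF pos] .
  finally show ?thesis .
qed

end
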